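(* If $\mathcal{C}$ is a $d$-uniform E-chordal clutter, then $\mathcal{C}\in\mathfrak{C}_d$, i.e. $\mathcal{C}$ is a chordal clutter.
   Context: A $d$-uniform clutter $\mathcal{C}$ on a finite vertex set $V(\mathcal{C})$ is a collection of $d$-element subsets of $V(\mathcal{C})$, called circuits. A $(d-1)$-subset $e$ of the vertex set is a submaximal circuit of $\mathcal{C}$ if $e\subset F$ for some $F\in\mathcal{C}$; $\mathrm{SC}(\mathcal{C})$ is the set of submaximal circuits. A set $V$ of vertices is a clique in $\mathcal{C}$ if all $d$-subsets of $V$ belong to $\mathcal{C}$ (sets with fewer than $d$ elements are cliques). $N_{\mathcal{C}}[e]=e\cup\{c: e\cup\{c\}\in\mathcal{C}\}$, and $e$ is simplicial in $\mathcal{C}$ if $N_{\mathcal{C}}[e]$ is a clique. The deletion is $\mathcal{C}\setminus e=\{F\in\mathcal{C}: e\nsubseteq F\}$ (same vertex set). Chordal: $\mathcal{C}$ is chordal if either $\mathcal{C}=\varnothing$ or (recursively) $\mathcal{C}$ admits a simplicial submaximal circuit $e$ such that $\mathcal{C}\setminus e$ is chordal. $\mathfrak{C}_d$ denotes the class of $d$-uniform chordal clutters. $\mathcal{C}_{n,d}$ is the complete $d$-uniform clutter on $n$ vertices: all $d$-subsets are circuits (for $n<d$ it consists of $n$ isolated vertices and has no circuits). E-chordal (generalized chordal in the sense of Emtander): the class of $d$-uniform clutters obtained inductively as follows. (i) $\mathcal{C}_{n,d}$ is E-chordal for $n,d\in\mathbb{N}$. (ii) If $\mathcal{C}$ is E-chordal,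 then so is $\mathcal{C}\cup_{\mathcal{C}_{i,d}}\mathcal{C}_{n,d}$ for $0\le i<n$: this is the clutter obtained by gluing a complete clutter $\mathcal{C}_{n,d}$ to $\mathcal{C}$ along a common complete subclutter $\mathcal{C}_{i,d}$, i.e. the vertex sets of $\mathcal{C}$ and of $\mathcal{C}_{n,d}$ intersect in a set $W$ with $|W|=i$ that is a clique of $\mathcal{C}$, and one takes the union of vertex sets and of circuits. (iii) If $\mathcal{C}$ is E-chordal, $F\subset V(\mathcal{C})$ with $|F|=d$, and there is $e\subset F$ with $|e|=d-1$ and $e\notin\mathrm{SC}(\mathcal{C})$, then $\mathcal{C}\cup\{F\}$ is E-chordal. *)

theory Defs
  imports Main
begin

text \<open>
  A clutter is given by its vertex set \<open>V\<close> and its set of circuits \<open>C\<close>. The vertex set is kept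
  explicitly because isolated vertices matter: gluing and adding circuits refer to them.
\<close>

definition uniform_clutter :: "nat \<Rightarrow> 'a set \<Rightarrow> 'a set set \<Rightarrow> bool" where
  "uniform_clutter d V C \<longleftrightarrow> finite V \<and> (\<forall>F\<in>C. F \<subseteq> V \<and> card F = d)"

text \<open>
  The natural subtraction \<open>d - 1\<close> below is the intended one only for \<open>d \<ge> 1\<close>; for \<open>d = 0\<close> there
  is no notion of a submaximal circuit.
\<close>

definition submaximal_circuits :: "nat \<Rightarrow> 'a set set \<Rightarrow> 'a set set" where
  "submaximal_circuits d C = {e. card e = d - 1 \<and> (\<exists>F\<in>C. e \<subset> F)}"

definition clique :: "nat \<Rightarrow> 'a set \<Rightarrow> 'a set set \<Rightarrow> 'a set \<Rightarrow> bool" where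
  "clique d V C W \<longleftrightarrow> W \<subseteq> V \<and> (\<forall>F. F \<subseteq> W \<and> card F = d \<longrightarrow> F \<in> C)"

definition closed_nbhd :: "'a set set \<Rightarrow> 'a set \<Rightarrow> 'a set" where
  "closed_nbhd C e = e \<union> {c. e \<union> {c} \<in> C}"

definition simplicial :: "nat \<Rightarrow> 'a set \<Rightarrow> 'a set set \<Rightarrow> 'a set \<Rightarrow> bool" where
  "simplicial d V C e \<longleftrightarrow> clique d V C (closed_nbhd C e)"

definition deletion :: "'a set set \<Rightarrow> 'a set \<Rightarrow> 'a set set" where
  "deletion C e = {F\<in>C. \<not> e \<subseteq> F}"

inductive_set chordal_clutters :: "nat \<Rightarrow> ('a set \<times> 'a set set) set" for d :: nat where
  empty: "uniform_clutter d V {} \<Longrightarrow> (V, {}) \<in> chordal_clutters d"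
| delete: "(V, C) \<in> chordal_clutters d"
    if "uniform_clutter d V C" and "e \<in> submaximal_circuits d C" and "simplicial d V C e"
      and "(V, deletion C e) \<in> chordal_clutters d"

definition complete_circuits :: "nat \<Rightarrow> 'a set \<Rightarrow> 'a set set" where
  "complete_circuits d U = {F. F \<subseteq> U \<and> card F = d}"

text \<open>
  The complete clutter on \<open>n\<close> vertices is realised on every finite vertex set \<open>U\<close> with
  \<open>card U = n\<close>. In rule \<open>glue\<close> the common complete subclutter lives on \<open>V \<inter> U\<close>, and the condition
  \<open>i < n\<close> becomes \<open>card (V \<inter> U) < card U\<close>.
\<close>

inductive E_chordal :: "nat \<Rightarrow> 'a set \<Rightarrow> 'a set set \<Rightarrow> bool" for d :: nat where
  complete: "finite U \<Longrightarrow> E_chordal d U (complete_circuits d U)"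
| glue: "E_chordal d (V \<union> U) (C \<union> complete_circuits d U)"
    if "E_chordal d V C" and "finite U" and "clique d V C (V \<inter> U)" and "card (V \<inter> U) < card U"
| add: "E_chordal d V (C \<union> {F})"
    if "E_chordal d V C" and "F \<subseteq> V" and "card F = d"
      and "e \<subset> F" and "card e = d - 1" and "e \<notin> submaximal_circuits d C"

end

theory Submission
  imports Defs
begin

text \<open>
  Gluing a complete clutter on \<open>U\<close> to \<open>C\<close> along a clique \<open>W\<close> can be done by adding the vertices of
  \<open>U - W\<close> one at a time: after each step, the vertices treated so far form a clique together with
  \<open>W\<close>, so the next step has the same shape. A complete clutter arises in the same way from the
  clutter without vertices. Hence the question reduces to a single new vertex \<open>v\<close>, whose circuits
  are the sets \<open>insert v G\<close> for \<open>G\<close> in the complete \<open>(d - 1)\<close>-uniform clutter \<open>D\<close> on \<open>W\<close>.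

  The proof that these circuits can be removed is by induction on \<open>d\<close> (lemma
  \<open>chordal_glue_complete\<close>); its step is lemma \<open>chordal_cone\<close>. If \<open>e\<close> is a simplicial
  submaximal circuit of the link \<open>D\<close> of \<open>v\<close>, then \<open>insert v e\<close> is one of the whole clutter: a
  \<open>d\<close>-subset of its closed neighbourhood that contains \<open>v\<close> is a circuit because \<open>e\<close> is simplicial in
  \<open>D\<close>, and a \<open>d\<close>-subset that avoids \<open>v\<close> lies in the clique \<open>W\<close>. Deleting \<open>insert v e\<close> amounts to
  deleting \<open>e\<close> from \<open>D\<close>. So a sequence of deletions that empties \<open>D\<close> turns into one that removes all
  circuits through \<open>v\<close>, and \<open>D\<close> has such a sequence by the induction hypothesis. For \<open>d = 1\<close> every
  clutter is chordal, since deleting the empty set removes all circuits.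

  Finally, when \<open>F\<close> is added because of a non-submaximal circuit \<open>e \<subset> F\<close>, the set \<open>F\<close> is the only
  circuit of the new clutter containing \<open>e\<close>. So \<open>e\<close> is simplicial there, with closed neighbourhood
  \<open>F\<close>, and its deletion restores the old clutter.
\<close>

lemma chordal_imp_uniform:
  "(V, C) \<in> chordal_clutters d \<Longrightarrow> uniform_clutter d V C"
  by (erule chordal_clutters.cases) auto

lemma chordal_add_isolated_vertices:
  assumes "(V, C) \<in> chordal_clutters d" and "finite V'" and "V \<subseteq> V'"
  shows "(V', C) \<in> chordal_clutters d"
  using assms(1,3)
proof (induction V C rule: chordal_clutters.induct)
  case (empty V)
  show ?case
    using assms(2) by (intro chordal_clutters.empty) (simp add: uniform_clutter_def)
next
  case (delete V C e)
  show ?case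
  proof (rule chordal_clutters.delete)
    show "uniform_clutter d V' C"
      using delete.hyps(1) delete.prems assms(2) unfolding uniform_clutter_def by blast
    show "simplicial d V' C e"
      using delete.hyps(3) delete.prems unfolding simplicial_def clique_def by blast
  qed (use delete in auto)
qed

text \<open>
  The clutter \<open>D\<close> is the link of the new vertex \<open>v\<close>. The vertex set \<open>W\<close> of \<open>D\<close> has to be a clique of
  \<open>C\<close>: this takes care of the \<open>(k + 1)\<close>-subsets of a closed neighbourhood that avoid \<open>v\<close>.
\<close>

lemma chordal_cone:
  assumes D: "(W, D) \<in> chordal_clutters k" and "k \<ge> 1"
    and C: "(V, C) \<in> chordal_clutters (Suc k)"
    and W: "clique (Suc k) V C W" and v: "v \<notin> V"
  shows "(insert v V, C \<union> insert v ` D) \<in> chordal_clutters (Suc k)"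
  using D W
proof (induction W D rule: chordal_clutters.induct)
  case (empty W)
  have "finite (insert v V)"
    using chordal_imp_uniform[OF C] by (simp add: uniform_clutter_def)
  then show ?case
    using chordal_add_isolated_vertices[OF C] by auto
next
  case (delete W D e)
  have UC: "finite V" "\<And>F. F \<in> C \<Longrightarrow> F \<subseteq> V \<and> card F = Suc k"
    using chordal_imp_uniform[OF C] by (auto simp: uniform_clutter_def)
  have UD: "finite W" "\<And>G. G \<in> D \<Longrightarrow> G \<subseteq> W \<and> card G = k"
    using delete.hyps(1) by (auto simp: uniform_clutter_def)
  have WV: "W \<subseteq> V" using delete.prems by (simp add: clique_def)
  obtain G where G: "G \<in> D" "e \<subset> G" and ce: "card e = k - 1"
    using delete.hyps(2) by (auto simp: submaximal_circuits_def)
  have "e \<subseteq> W" using G UD(2) by blast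
  then have eW: "e \<subseteq> W" "finite e" "v \<notin> e"
    using UD(1) WV v by (auto intro: finite_subset)
  have vC: "v \<notin> F" if "F \<in> C" for F using UC(2)[OF that] v by blast
  have vD: "v \<notin> G" if "G \<in> D" for G using UD(2)[OF that] WV v by blast
  let ?C = "C \<union> insert v ` D"
  show ?case
  proof (rule chordal_clutters.delete)
    show "uniform_clutter (Suc k) (insert v V) ?C"
      unfolding uniform_clutter_def
    proof (intro conjI ballI)
      fix F assume F: "F \<in> ?C"
      show "F \<subseteq> insert v V" using F UC UD WV by blast
      show "card F = Suc k"
        using F UC(2) UD vD by (auto simp: card_insert_disjoint[OF finite_subset[OF _ UD(1)]])
    qed (use UC(1) in simp)
    show "insert v e \<in> submaximal_circuits (Suc k) ?C"
      unfolding submaximal_circuits_def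
    proof (intro CollectI conjI bexI)
      show "card (insert v e) = Suc k - 1" using eW ce \<open>k \<ge> 1\<close> by simp
      show "insert v e \<subset> insert v G" using G(2) vD[OF G(1)] eW(3)
        by (auto simp: psubset_eq insert_ident)
    qed (use G in auto)
    have N: "closed_nbhd ?C (insert v e) \<subseteq> insert v (closed_nbhd D e)"
    proof
      fix c assume c: "c \<in> closed_nbhd ?C (insert v e)"
      show "c \<in> insert v (closed_nbhd D e)"
      proof (cases "c \<in> insert v e")
        case True
        then show ?thesis by (auto simp: closed_nbhd_def)
      next
        case False
        then obtain H where H: "H \<in> D" "insert v e \<union> {c} = insert v H"
          using c vC by (auto simp: closed_nbhd_def)
        moreover have "v \<notin> e \<union> {c}" using eW(3) False by auto
        ultimately have "H = e \<union> {c}"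
          using vD[OF H(1)] insert_ident[of v H "e \<union> {c}"] by (simp add: insert_commute)
        then show ?thesis using H by (auto simp: closed_nbhd_def)
      qed
    qed
    have S: "closed_nbhd D e \<subseteq> W"
      and S': "\<And>F. F \<subseteq> closed_nbhd D e \<Longrightarrow> card F = k \<Longrightarrow> F \<in> D"
      using delete.hyps(3) by (auto simp: simplicial_def clique_def)
    show "simplicial (Suc k) (insert v V) ?C (insert v e)"
      unfolding simplicial_def clique_def
    proof (intro conjI allI impI)
      show "closed_nbhd ?C (insert v e) \<subseteq> insert v V" using N S WV by blast
      fix F assume F: "F \<subseteq> closed_nbhd ?C (insert v e) \<and> card F = Suc k"
      show "F \<in> ?C"
      proof (cases "v \<in> F")
        case True
        have "F - {v} \<in> D"
          using F N True by (intro S') auto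
        then have "insert v (F - {v}) \<in> insert v ` D" by (rule imageI)
        then show ?thesis using True by (simp add: insert_absorb)
      next
        case False
        then have "F \<subseteq> W" using F N S by blast
        then show ?thesis using F delete.prems by (simp add: clique_def)
      qed
    qed
    have "insert v e \<subseteq> insert v G \<longleftrightarrow> e \<subseteq> G" for G using eW(3) by blast
    then have "deletion ?C (insert v e) = C \<union> insert v ` deletion D e"
      using vC unfolding deletion_def by auto
    then show "(insert v V, deletion ?C (insert v e)) \<in> chordal_clutters (Suc k)"
      using delete.IH[OF delete.prems] by simp
  qed
qed

lemma chordal_1_uniform:
  assumes "uniform_clutter 1 V C"
  shows "(V, C) \<in> chordal_clutters 1"
proof (cases "C = {}")
  case True
  then show ?thesis using assms chordal_clutters.empty by blast
next
  case False
  show ?thesis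
  proof (rule chordal_clutters.delete[OF assms])
    show "{} \<in> submaximal_circuits 1 C"
      using False assms by (fastforce simp: submaximal_circuits_def uniform_clutter_def)
    show "simplicial 1 V C {}"
      using assms
      by (auto simp: simplicial_def clique_def closed_nbhd_def uniform_clutter_def card_1_singleton_iff)
    show "(V, deletion C {}) \<in> chordal_clutters 1"
      using assms by (auto simp: deletion_def uniform_clutter_def intro: chordal_clutters.empty)
  qed
qed

lemma complete_circuits_insert:
  assumes "finite W" and "v \<notin> W"
  shows "complete_circuits (Suc k) (insert v W) =
    complete_circuits (Suc k) W \<union> insert v ` complete_circuits k W"
proof (intro equalityI subsetI)
  fix F assume F: "F \<in> complete_circuits (Suc k) (insert v W)"
  show "F \<in> complete_circuits (Suc k) W \<union> insert v ` complete_circuits k W"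
  proof (cases "v \<in> F")
    case True
    then have "F - {v} \<in> complete_circuits k W"
      using F by (auto simp: complete_circuits_def)
    then have "insert v (F - {v}) \<in> insert v ` complete_circuits k W" by (rule imageI)
    then show ?thesis using True by (simp add: insert_absorb)
  next
    case False
    then show ?thesis using F by (auto simp: complete_circuits_def)
  qed
next
  fix F assume "F \<in> complete_circuits (Suc k) W \<union> insert v ` complete_circuits k W"
  then show "F \<in> complete_circuits (Suc k) (insert v W)"
  proof
    assume "F \<in> insert v ` complete_circuits k W"
    then obtain G where G: "F = insert v G" "G \<subseteq> W" "card G = k"
      by (auto simp: complete_circuits_def)
    moreover have "finite G" "v \<notin> G" using G assms by (auto intro: finite_subset)
    ultimately show ?thesis by (auto simp: complete_circuits_def)
  qed (auto simp: complete_circuits_def)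
qed

text \<open>
  The set \<open>A\<close> consists of the vertices of the glued complete clutter that are new. For
  \<open>V = W = {}\<close> the result is the complete clutter on \<open>A\<close>; in the induction on \<open>d\<close> this instance of
  the hypothesis provides the links of the new vertices.
\<close>

lemma chordal_glue_complete:
  assumes "d \<ge> 1" and "(V, C) \<in> chordal_clutters d" and "clique d V C W"
    and "finite A" and "A \<inter> V = {}"
  shows "(V \<union> A, C \<union> complete_circuits d (W \<union> A)) \<in> chordal_clutters d"
  using assms
proof (induction d arbitrary: V C W A rule: nat_induct_at_least)
  case base
  have "uniform_clutter 1 V C" using base chordal_imp_uniform by blast
  then have "uniform_clutter 1 (V \<union> A) (C \<union> complete_circuits 1 (W \<union> A))"
    using base by (auto simp: uniform_clutter_def complete_circuits_def clique_def)
  then show ?case by (rule chordal_1_uniform)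
next
  case (Suc k)
  have complete: "(U, complete_circuits k U) \<in> chordal_clutters k" if "finite U" for U :: "'a set"
  proof -
    have "({}, {}) \<in> chordal_clutters k"
      by (rule chordal_clutters.empty) (simp add: uniform_clutter_def)
    \<comment> \<open>As \<open>k\<close> is positive, the empty set of vertices is a clique even without circuits.\<close>
    moreover have "clique k {} {} {}" using \<open>1 \<le> k\<close> by (auto simp: clique_def)
    ultimately show ?thesis using Suc.IH[of "{}" "{}" "{}" U] that by simp
  qed
  have WV: "W \<subseteq> V" "complete_circuits (Suc k) W \<subseteq> C"
    using Suc.prems(2) by (auto simp: clique_def complete_circuits_def)
  have "finite W"
    using chordal_imp_uniform[OF Suc.prems(1)] WV
    by (auto simp: uniform_clutter_def intro: finite_subset)
  show ?case using Suc.prems(3,4)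
  proof (induction A rule: finite_induct)
    case empty
    then show ?case using WV Suc.prems(1) by (simp add: Un_absorb2)
  next
    case (insert v A)
    let ?B = "W \<union> A" and ?C = "C \<union> complete_circuits (Suc k) (W \<union> A)"
    have v: "v \<notin> V \<union> A" "v \<notin> ?B" and "finite ?B"
      using insert \<open>finite W\<close> WV by auto
    have IH: "(V \<union> A, ?C) \<in> chordal_clutters (Suc k)" using insert by blast
    have "clique (Suc k) (V \<union> A) ?C ?B"
      using WV by (auto simp: clique_def complete_circuits_def)
    then have "(insert v (V \<union> A), ?C \<union> insert v ` complete_circuits k ?B)
      \<in> chordal_clutters (Suc k)"
      using chordal_cone[OF complete[OF \<open>finite ?B\<close>] \<open>1 \<le> k\<close> IH _ v(1)] by blast
    then show ?case
      using complete_circuits_insert[OF \<open>finite ?B\<close> v(2), of k] by (simp add: Un_assoc)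
  qed
qed

lemma chordal_add_circuit:
  assumes "d \<ge> 1" and C: "(V, C) \<in> chordal_clutters d" and F: "F \<subseteq> V" "card F = d"
    and e: "e \<subset> F" "card e = d - 1" "e \<notin> submaximal_circuits d C"
  shows "(V, C \<union> {F}) \<in> chordal_clutters d"
proof (rule chordal_clutters.delete)
  have U: "uniform_clutter d V C" using C by (rule chordal_imp_uniform)
  have "finite F" using F \<open>d \<ge> 1\<close> by (intro card_ge_0_finite) simp
  have no: "\<not> e \<subseteq> G" if "G \<in> C" for G
  proof
    assume "e \<subseteq> G"
    moreover have "card G = d" using U that by (simp add: uniform_clutter_def)
    ultimately have "e \<subset> G" using e(2) \<open>d \<ge> 1\<close> by auto
    then show False using e(2,3) that by (auto simp: submaximal_circuits_def)
  qed
  show "uniform_clutter d V (C \<union> {F})" using U F by (auto simp: uniform_clutter_def)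
  show "e \<in> submaximal_circuits d (C \<union> {F})" using e by (auto simp: submaximal_circuits_def)
  have N: "closed_nbhd (C \<union> {F}) e \<subseteq> F" using no e(1) by (auto simp: closed_nbhd_def)
  have "G = F" if "G \<subseteq> F" "card G = d" for G
    using that \<open>finite F\<close> F(2) by (simp add: card_subset_eq)
  then show "simplicial d V (C \<union> {F}) e"
    using N F(1) unfolding simplicial_def clique_def by blast
  have "deletion (C \<union> {F}) e = C" using no e(1) by (auto simp: deletion_def)
  then show "(V, deletion (C \<union> {F}) e) \<in> chordal_clutters d" using C by simp
qed

theorem proposition3p13:
  fixes d :: nat and V :: "'a set" and C :: "'a set set"
  assumes "d \<ge> 1"
    and "E_chordal d V C"
  shows "(V, C) \<in> chordal_clutters d"
  using assms(2)
proof (induction rule: E_chordal.induct)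
  case (complete U)
  have "({}, {}) \<in> chordal_clutters d"
    by (rule chordal_clutters.empty) (simp add: uniform_clutter_def)
  moreover have "clique d {} {} {}" using assms(1) by (auto simp: clique_def)
  ultimately show ?case
    using chordal_glue_complete[OF assms(1), of "{}" "{}" "{}" U] complete by simp
next
  case (glue V C U)
  have "V \<inter> U \<union> (U - V) = U" by blast
  then show ?case
    using chordal_glue_complete[OF assms(1) glue.IH, of "V \<inter> U" "U - V"] glue.hyps by auto
next
  case (add V C F e)
  then show ?case using chordal_add_circuit[OF assms(1)] by blast
qed

end
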